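(* Let $\psi$ be a first-order formula (i.e. containing no dependence atoms), let $M$ be a first-order model over a signature containing that of $\psi$, and let $X$ be a team over $M$ whose domain contains the free variables of $\psi$. Then: (1) $(M,X)\models_P^+\psi$ if and only if there is an $s\in X$ such that $M\models_s\psi$ in the usual first-order (Tarskian) sense; (2) $(M,X)\models_P^-\psi$ if and only if there is an $s\in X$ such that $M\not\models_s\psi$ in the usual first-order (Tarskian) sense.
   Context: Syntax. Over a first-order signature $\Sigma$, the formulas (of Dependence Logic, equivalently of Paraconsistent Non-dependence Logic) are $\psi ::= R\vec t \mid t_1=t_2 \mid {=}(\vec t_1,\vec t_2) \mid \lnot\psi \mid \psi\vee\psi \mid \exists v\,\psi$, where $\vec t,\vec t_1,\vec t_2$ are (possibly empty) tuples of $\Sigma$-terms; ${=}(\vec t_1,\vec t_2)$ is called a dependence atom. $\psi\wedge\theta$ abbreviates $\lnot(\lnot\psi\vee\lnot\theta)$ and $\forall v\,\psi$ abbreviates $\lnot\exists v\lnot\psi$. Free variables are defined as usual (all variables in an atom, including dependence atoms, are free). Teams. Models have nonempty domain. A team over $M$ with domain $V$ is a set $X$ of assignments $s:V\to\mathrm{Dom}(M)$. $\vec t\langle s\rangle$ denotes the value of the tuple $\vec t$ under $s$. Games. Let $\mathrm{Free}(\psi)\subseteq\mathrm{Dom}(X)$. The game $G^M_X(\psi)$ is played by Eloise and Abelard; $\alpha^*$ denotes the opponent of $\alpha$. Positions are triples $(\chi,s,\alpha)$ with $\chi$ an occurrence of a subformula of $\psi$, $s$ an assignment and $\alpha$ a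 player; the possible starting positions are $(\psi,s,\text{Eloise})$ for $s\in X$. Rules: at $(R\vec t,s,\alpha)$ or $(t_1=t_2,s,\alpha)$, $\alpha$ wins if the atom is true in $M$ under $s$, otherwise $\alpha^*$ wins; at $({=}(\vec t_1,\vec t_2),s,\alpha)$, $\alpha$ wins; from $(\lnot\chi,s,\alpha)$ the game moves to $(\chi,s,\alpha^* )$; from $(\chi\vee\theta,s,\alpha)$, $\alpha$ chooses $(\chi,s,\alpha)$ or $(\theta,s,\alpha)$; from $(\exists v\chi,s,\alpha)$, $\alpha$ chooses $m\in\mathrm{Dom}(M)$ and the game moves to $(\chi,s[m/v],\alpha)$. A (possibly nondeterministic) strategy for a player selects a nonempty set of allowed successors at each position where that player chooses; it is winning if every play from any starting position in which the player's choices conform to it is won by that player. A strategy for $\alpha$ is uniform if for any two plays conforming to it and ending in $({=}(\vec t_1,\vec t_2),s,\alpha)$ and $({=}(\vec t_1,\vec t_2),s',\alpha)$ for the same occurrence of the dependence atom, $\vec t_1\langle s\rangle=\vec t_1\langle s'\rangle$ implies $\vec t_2\langle s\rangle=\vec t_2\langle s'\rangle$. Paraconsistent satisfaction. $(M,X)\models_P^+\psi$ iff Abelard has no uniform winning strategy in $G^M_X(\psi)$; $(M,X)\models_P^-\psi$ iff Eloise has no uniform winning strategy in $G^M_X(\psi)$. *)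

theory Defs
  imports Main
begin

subsection \<open>Syntax\<close>

datatype ('f, 'v) trm = Var 'v | Fn 'f "('f, 'v) trm list"

datatype ('f, 'r, 'v) fm =
    Rel 'r "('f, 'v) trm list"
  | Eq "('f, 'v) trm" "('f, 'v) trm"
  | Dep "('f, 'v) trm list" "('f, 'v) trm list"
  | Neg "('f, 'r, 'v) fm"
  | Disj "('f, 'r, 'v) fm" "('f, 'r, 'v) fm"
  | Exists 'v "('f, 'r, 'v) fm"

text \<open>A signature assigns an arity to each of its function and relation symbols;
  symbols mapped to \<^term>\<open>None\<close> do not belong to it.\<close>

record ('f, 'r) signature =
  fun_arity :: "'f \<Rightarrow> nat option"
  rel_arity :: "'r \<Rightarrow> nat option"

definition subsignature :: "('f, 'r) signature \<Rightarrow> ('f, 'r) signature \<Rightarrow> bool" where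
  "subsignature S S' \<longleftrightarrow>
     fun_arity S \<subseteq>\<^sub>m fun_arity S' \<and> rel_arity S \<subseteq>\<^sub>m rel_arity S'"

fun trm_over :: "('f, 'r) signature \<Rightarrow> ('f, 'v) trm \<Rightarrow> bool" where
  "trm_over S (Var v) \<longleftrightarrow> True"
| "trm_over S (Fn f ts) \<longleftrightarrow>
     fun_arity S f = Some (length ts) \<and> (\<forall>t\<in>set ts. trm_over S t)"

fun fm_over :: "('f, 'r) signature \<Rightarrow> ('f, 'r, 'v) fm \<Rightarrow> bool" where
  "fm_over S (Rel R ts) \<longleftrightarrow>
     rel_arity S R = Some (length ts) \<and> (\<forall>t\<in>set ts. trm_over S t)"
| "fm_over S (Eq t u) \<longleftrightarrow> trm_over S t \<and> trm_over S u"
| "fm_over S (Dep ts us) \<longleftrightarrow> (\<forall>t\<in>set ts \<union> set us. trm_over S t)"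
| "fm_over S (Neg \<chi>) \<longleftrightarrow> fm_over S \<chi>"
| "fm_over S (Disj \<chi> \<theta>) \<longleftrightarrow> fm_over S \<chi> \<and> fm_over S \<theta>"
| "fm_over S (Exists v \<chi>) \<longleftrightarrow> fm_over S \<chi>"

fun first_order :: "('f, 'r, 'v) fm \<Rightarrow> bool" where
  "first_order (Rel R ts) \<longleftrightarrow> True"
| "first_order (Eq t u) \<longleftrightarrow> True"
| "first_order (Dep ts us) \<longleftrightarrow> False"
| "first_order (Neg \<chi>) \<longleftrightarrow> first_order \<chi>"
| "first_order (Disj \<chi> \<theta>) \<longleftrightarrow> first_order \<chi> \<and> first_order \<theta>"
| "first_order (Exists v \<chi>) \<longleftrightarrow> first_order \<chi>"

fun trm_vars :: "('f, 'v) trm \<Rightarrow> 'v set" where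
  "trm_vars (Var v) = {v}"
| "trm_vars (Fn f ts) = (\<Union>t\<in>set ts. trm_vars t)"

fun free_vars :: "('f, 'r, 'v) fm \<Rightarrow> 'v set" where
  "free_vars (Rel R ts) = (\<Union>t\<in>set ts. trm_vars t)"
| "free_vars (Eq t u) = trm_vars t \<union> trm_vars u"
| "free_vars (Dep ts us) = (\<Union>t\<in>set ts \<union> set us. trm_vars t)"
| "free_vars (Neg \<chi>) = free_vars \<chi>"
| "free_vars (Disj \<chi> \<theta>) = free_vars \<chi> \<union> free_vars \<theta>"
| "free_vars (Exists v \<chi>) = free_vars \<chi> - {v}"


subsection \<open>Models, assignments and teams\<close>

record ('f, 'r, 'a) fo_model =
  Dom :: "'a set"
  fun_int :: "'f \<Rightarrow> 'a list \<Rightarrow> 'a"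
  rel_int :: "'r \<Rightarrow> 'a list set"

definition tuples :: "'a set \<Rightarrow> nat \<Rightarrow> 'a list set" where
  "tuples A n = {as. length as = n \<and> set as \<subseteq> A}"

definition model_over :: "('f, 'r) signature \<Rightarrow> ('f, 'r, 'a) fo_model \<Rightarrow> bool" where
  "model_over S M \<longleftrightarrow>
     Dom M \<noteq> {} \<and>
     (\<forall>f n. fun_arity S f = Some n \<longrightarrow> (\<forall>as\<in>tuples (Dom M) n. fun_int M f as \<in> Dom M)) \<and>
     (\<forall>R n. rel_arity S R = Some n \<longrightarrow> rel_int M R \<subseteq> tuples (Dom M) n)"

text \<open>An assignment with domain \<open>V\<close> is a partial map whose domain is exactly \<open>V\<close>.\<close>

type_synonym ('v, 'a) assignment = "'v \<Rightarrow> 'a option"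

definition team :: "('f, 'r, 'a) fo_model \<Rightarrow> 'v set \<Rightarrow> ('v, 'a) assignment set \<Rightarrow> bool" where
  "team M V X \<longleftrightarrow> (\<forall>s\<in>X. dom s = V \<and> ran s \<subseteq> Dom M)"

text \<open>The value of a term is only meaningful if all its variables are in the domain of the
  assignment.\<close>

fun trm_val :: "('f, 'r, 'a) fo_model \<Rightarrow> ('v, 'a) assignment \<Rightarrow> ('f, 'v) trm \<Rightarrow> 'a" where
  "trm_val M s (Var v) = the (s v)"
| "trm_val M s (Fn f ts) = fun_int M f (map (trm_val M s) ts)"

definition tuple_val ::
    "('f, 'r, 'a) fo_model \<Rightarrow> ('v, 'a) assignment \<Rightarrow> ('f, 'v) trm list \<Rightarrow> 'a list" where
  "tuple_val M s ts = map (trm_val M s) ts"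

text \<open>Tarskian satisfaction, left unspecified on dependence atoms.\<close>

primrec (nonexhaustive) tarski_sat ::
    "('f, 'r, 'a) fo_model \<Rightarrow> ('v, 'a) assignment \<Rightarrow> ('f, 'r, 'v) fm \<Rightarrow> bool" where
  "tarski_sat M s (Rel R ts) \<longleftrightarrow> tuple_val M s ts \<in> rel_int M R"
| "tarski_sat M s (Eq t u) \<longleftrightarrow> trm_val M s t = trm_val M s u"
| "tarski_sat M s (Neg \<chi>) \<longleftrightarrow> \<not> tarski_sat M s \<chi>"
| "tarski_sat M s (Disj \<chi> \<theta>) \<longleftrightarrow> tarski_sat M s \<chi> \<or> tarski_sat M s \<theta>"
| "tarski_sat M s (Exists v \<chi>) \<longleftrightarrow> (\<exists>m\<in>Dom M. tarski_sat M (s(v \<mapsto> m)) \<chi>)"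


subsection \<open>The semantic game\<close>

datatype player = Eloise | Abelard

fun opponent :: "player \<Rightarrow> player" where
  "opponent Eloise = Abelard"
| "opponent Abelard = Eloise"

text \<open>An occurrence of a subformula is the subformula together with its address in the syntax
  tree, i.e. the list of child indices leading from the root to it.\<close>

type_synonym ('f, 'r, 'v) occurrence = "nat list \<times> ('f, 'r, 'v) fm"

inductive_set occurrences :: "('f, 'r, 'v) fm \<Rightarrow> ('f, 'r, 'v) occurrence set"
  for \<psi> :: "('f, 'r, 'v) fm" where
  root: "([], \<psi>) \<in> occurrences \<psi>"
| neg: "(p, Neg \<chi>) \<in> occurrences \<psi> \<Longrightarrow> (p @ [0], \<chi>) \<in> occurrences \<psi>"
| disj_left: "(p, Disj \<chi> \<theta>) \<in> occurrences \<psi> \<Longrightarrow> (p @ [0], \<chi>) \<in> occurrences \<psi>"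
| disj_right: "(p, Disj \<chi> \<theta>) \<in> occurrences \<psi> \<Longrightarrow> (p @ [1], \<theta>) \<in> occurrences \<psi>"
| exi: "(p, Exists v \<chi>) \<in> occurrences \<psi> \<Longrightarrow> (p @ [0], \<chi>) \<in> occurrences \<psi>"

type_synonym ('f, 'r, 'v, 'a) position =
  "('f, 'r, 'v) occurrence \<times> ('v, 'a) assignment \<times> player"

definition positions ::
    "('f, 'r, 'a) fo_model \<Rightarrow> ('f, 'r, 'v) fm \<Rightarrow> ('f, 'r, 'v, 'a) position set" where
  "positions M \<psi> = {(occ, s, \<alpha>). occ \<in> occurrences \<psi> \<and> ran s \<subseteq> Dom M}"

definition starting_positions ::
    "('f, 'r, 'v) fm \<Rightarrow> ('v, 'a) assignment set \<Rightarrow> ('f, 'r, 'v, 'a) position set" where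
  "starting_positions \<psi> X = {(([], \<psi>), s, Eloise) | s. s \<in> X}"

fun successors ::
    "('f, 'r, 'a) fo_model \<Rightarrow> ('f, 'r, 'v, 'a) position \<Rightarrow> ('f, 'r, 'v, 'a) position set" where
  "successors M ((p, Rel R ts), s, \<alpha>) = {}"
| "successors M ((p, Eq t u), s, \<alpha>) = {}"
| "successors M ((p, Dep ts us), s, \<alpha>) = {}"
| "successors M ((p, Neg \<chi>), s, \<alpha>) = {((p @ [0], \<chi>), s, opponent \<alpha>)}"
| "successors M ((p, Disj \<chi> \<theta>), s, \<alpha>) = {((p @ [0], \<chi>), s, \<alpha>), ((p @ [1], \<theta>), s, \<alpha>)}"
| "successors M ((p, Exists v \<chi>), s, \<alpha>) = {((p @ [0], \<chi>), s(v \<mapsto> m), \<alpha>) | m. m \<in> Dom M}"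

fun chooses :: "player \<Rightarrow> ('f, 'r, 'v, 'a) position \<Rightarrow> bool" where
  "chooses \<alpha> ((p, Disj \<chi> \<theta>), s, \<beta>) \<longleftrightarrow> \<alpha> = \<beta>"
| "chooses \<alpha> ((p, Exists v \<chi>), s, \<beta>) \<longleftrightarrow> \<alpha> = \<beta>"
| "chooses \<alpha> _ \<longleftrightarrow> False"

text \<open>The winner at a final position, i.e. one at an atomic formula; unspecified elsewhere.\<close>

fun winner :: "('f, 'r, 'a) fo_model \<Rightarrow> ('f, 'r, 'v, 'a) position \<Rightarrow> player" where
  "winner M ((p, Rel R ts), s, \<alpha>) =
     (if tuple_val M s ts \<in> rel_int M R then \<alpha> else opponent \<alpha>)"
| "winner M ((p, Eq t u), s, \<alpha>) = (if trm_val M s t = trm_val M s u then \<alpha> else opponent \<alpha>)"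
| "winner M ((p, Dep ts us), s, \<alpha>) = \<alpha>"

text \<open>Plays are complete: as models are nonempty, a position without successors is one at an
  atomic formula.  Every play is finite, since each move descends in the syntax tree.\<close>

definition play ::
    "('f, 'r, 'a) fo_model \<Rightarrow> ('v, 'a) assignment set \<Rightarrow> ('f, 'r, 'v) fm
     \<Rightarrow> ('f, 'r, 'v, 'a) position list \<Rightarrow> bool" where
  "play M X \<psi> \<pi> \<longleftrightarrow>
     \<pi> \<noteq> [] \<and> hd \<pi> \<in> starting_positions \<psi> X \<and>
     (\<forall>i. Suc i < length \<pi> \<longrightarrow> \<pi> ! Suc i \<in> successors M (\<pi> ! i)) \<and>
     successors M (last \<pi>) = {}"

type_synonym ('f, 'r, 'v, 'a) strategy =
  "('f, 'r, 'v, 'a) position \<Rightarrow> ('f, 'r, 'v, 'a) position set"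

definition strategy_for ::
    "('f, 'r, 'a) fo_model \<Rightarrow> ('f, 'r, 'v) fm \<Rightarrow> player
     \<Rightarrow> ('f, 'r, 'v, 'a) strategy \<Rightarrow> bool" where
  "strategy_for M \<psi> \<alpha> \<sigma> \<longleftrightarrow>
     (\<forall>P\<in>positions M \<psi>. chooses \<alpha> P \<longrightarrow> \<sigma> P \<noteq> {} \<and> \<sigma> P \<subseteq> successors M P)"

definition conforms ::
    "player \<Rightarrow> ('f, 'r, 'v, 'a) strategy \<Rightarrow> ('f, 'r, 'v, 'a) position list \<Rightarrow> bool" where
  "conforms \<alpha> \<sigma> \<pi> \<longleftrightarrow>
     (\<forall>i. Suc i < length \<pi> \<longrightarrow> chooses \<alpha> (\<pi> ! i) \<longrightarrow> \<pi> ! Suc i \<in> \<sigma> (\<pi> ! i))"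

definition winning ::
    "('f, 'r, 'a) fo_model \<Rightarrow> ('v, 'a) assignment set \<Rightarrow> ('f, 'r, 'v) fm \<Rightarrow> player
     \<Rightarrow> ('f, 'r, 'v, 'a) strategy \<Rightarrow> bool" where
  "winning M X \<psi> \<alpha> \<sigma> \<longleftrightarrow>
     (\<forall>\<pi>. play M X \<psi> \<pi> \<longrightarrow> conforms \<alpha> \<sigma> \<pi> \<longrightarrow> winner M (last \<pi>) = \<alpha>)"

definition uniform ::
    "('f, 'r, 'a) fo_model \<Rightarrow> ('v, 'a) assignment set \<Rightarrow> ('f, 'r, 'v) fm \<Rightarrow> player
     \<Rightarrow> ('f, 'r, 'v, 'a) strategy \<Rightarrow> bool" where
  "uniform M X \<psi> \<alpha> \<sigma> \<longleftrightarrow>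
     (\<forall>\<pi> \<pi>' p ts us s s'.
        play M X \<psi> \<pi> \<longrightarrow> conforms \<alpha> \<sigma> \<pi> \<longrightarrow> last \<pi> = ((p, Dep ts us), s, \<alpha>) \<longrightarrow>
        play M X \<psi> \<pi>' \<longrightarrow> conforms \<alpha> \<sigma> \<pi>' \<longrightarrow> last \<pi>' = ((p, Dep ts us), s', \<alpha>) \<longrightarrow>
        tuple_val M s ts = tuple_val M s' ts \<longrightarrow> tuple_val M s us = tuple_val M s' us)"

definition has_uniform_winning_strategy ::
    "('f, 'r, 'a) fo_model \<Rightarrow> ('v, 'a) assignment set \<Rightarrow> ('f, 'r, 'v) fm \<Rightarrow> player \<Rightarrow> bool" where
  "has_uniform_winning_strategy M X \<psi> \<alpha> \<longleftrightarrow>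
     (\<exists>\<sigma>. strategy_for M \<psi> \<alpha> \<sigma> \<and> uniform M X \<psi> \<alpha> \<sigma> \<and> winning M X \<psi> \<alpha> \<sigma>)"


subsection \<open>Paraconsistent satisfaction\<close>

definition para_sat_pos ::
    "('f, 'r, 'a) fo_model \<Rightarrow> ('v, 'a) assignment set \<Rightarrow> ('f, 'r, 'v) fm \<Rightarrow> bool" where
  "para_sat_pos M X \<psi> \<longleftrightarrow> \<not> has_uniform_winning_strategy M X \<psi> Abelard"

definition para_sat_neg ::
    "('f, 'r, 'a) fo_model \<Rightarrow> ('v, 'a) assignment set \<Rightarrow> ('f, 'r, 'v) fm \<Rightarrow> bool" where
  "para_sat_neg M X \<psi> \<longleftrightarrow> \<not> has_uniform_winning_strategy M X \<psi> Eloise"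

end

theory Submission
  imports Defs
begin

text \<open>The game of a first-order formula is a determined game of perfect information, with a
  winning region given by Tarskian truth: a player is favoured at a position iff the formula
  there is true and the position belongs to that player, or it is false and the position belongs
  to the opponent. A favoured player can keep being favoured by moving within the region, and
  the player who is not favoured can be kept outside of it against any strategy. Uniformity
  is vacuous, as no play ends in a dependence atom.\<close>

fun favoured ::
    "('f, 'r, 'a) fo_model \<Rightarrow> player \<Rightarrow> ('f, 'r, 'v, 'a) position \<Rightarrow> bool" where
  "favoured M \<alpha> ((p, \<chi>), s, \<beta>) \<longleftrightarrow> (\<alpha> = \<beta> \<longleftrightarrow> tarski_sat M s \<chi>)"

fun first_order_position :: "('f, 'r, 'v, 'a) position \<Rightarrow> bool" where
  "first_order_position ((p, \<chi>), s, \<beta>) \<longleftrightarrow> first_order \<chi>"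

text \<open>\<open>strategy_for\<close> demands a nonempty choice at every position where the player
  chooses, reachable or not. Outside the winning region, where a favoured successor cannot be relied
  on, all moves are therefore allowed.\<close>

definition favoured_moves ::
    "('f, 'r, 'a) fo_model \<Rightarrow> player \<Rightarrow> ('f, 'r, 'v, 'a) strategy" where
  "favoured_moves M \<alpha> P =
     (if favoured M \<alpha> P then {Q \<in> successors M P. favoured M \<alpha> Q} else successors M P)"

lemma eq_opponent_iff: "\<alpha> = opponent \<beta> \<longleftrightarrow> \<alpha> \<noteq> \<beta>"
  by (cases \<alpha>; cases \<beta>) auto

lemma successors_first_order:
  assumes "first_order_position P" and "Q \<in> successors M P"
  shows "first_order_position Q"
  using assms by (cases "(M, P)" rule: successors.cases) auto

lemma successors_size:
  assumes "Q \<in> successors M P"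
  shows "size (snd (fst Q)) < size (snd (fst P))"
  using assms by (cases "(M, P)" rule: successors.cases) auto

lemma successors_in_positions:
  assumes "P \<in> positions M \<psi>" and "Q \<in> successors M P"
  shows "Q \<in> positions M \<psi>"
  using assms
  \<comment> \<open>The simplifier rewrites the child index \<open>1\<close> to
    \<open>Suc 0\<close>, so \<open>disj_right\<close> is also supplied in that form.\<close>
  by (cases "(M, P)" rule: successors.cases)
    (fastforce simp: positions_def ran_def subset_iff
      intro: occurrences.intros disj_right[simplified] split: if_splits)+

lemma chooses_successors_nonempty:
  assumes "Dom M \<noteq> {}" and "chooses \<alpha> P"
  shows "successors M P \<noteq> {}"
  using assms by (cases "(M, P)" rule: successors.cases) auto

text \<open>A nonempty domain gives every existential position a successor, so \<open>P\<close> is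
  at an atom, where the rule for the winner is the truth of the atom relative to the player holding
  the position.\<close>

lemma winner_iff_favoured:
  assumes "Dom M \<noteq> {}" and "first_order_position P" and "successors M P = {}"
  shows "winner M P = \<alpha> \<longleftrightarrow> favoured M \<alpha> P"
  using assms eq_opponent_iff
  by (cases "(M, P)" rule: successors.cases) (auto split: if_splits)

text \<open>Here the formula is true: a true disjunction has a true disjunct, a true existential a
  witness.\<close>

lemma favoured_move_exists:
  assumes "favoured M \<alpha> P" and "first_order_position P" and "chooses \<alpha> P"
  shows "\<exists>Q\<in>successors M P. favoured M \<alpha> Q"
  using assms by (cases "(M, P)" rule: successors.cases) auto

text \<open>Either the move is at a negation, which flips both truth value and player, or the
  opponent chooses at a false formula, all of whose disjuncts or instances are false.\<close>

lemma favoured_opponent_move: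
  assumes "favoured M \<alpha> P" and "first_order_position P" and "\<not> chooses \<alpha> P"
    and "Q \<in> successors M P"
  shows "favoured M \<alpha> Q"
  using assms by (cases "(M, P)" rule: successors.cases) (auto simp: eq_opponent_iff)

lemma unfavoured_move:
  assumes "\<not> favoured M \<alpha> P" and "first_order_position P" and "chooses \<alpha> P"
    and "Q \<in> successors M P"
  shows "\<not> favoured M \<alpha> Q"
  using assms by (cases "(M, P)" rule: successors.cases) (auto simp: eq_opponent_iff)

text \<open>Dual to \<open>favoured_move_exists\<close>: the opponent holds a true formula and picks
  a true disjunct or a witness. At a negation the only move preserves the status.\<close>

lemma unfavoured_opponent_move_exists:
  assumes "\<not> favoured M \<alpha> P" and "first_order_position P" and "\<not> chooses \<alpha> P"
    and "successors M P \<noteq> {}"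
  shows "\<exists>Q\<in>successors M P. \<not> favoured M \<alpha> Q"
  using assms by (cases "(M, P)" rule: successors.cases) (auto simp: eq_opponent_iff)

lemma play_first_order:
  assumes "first_order \<psi>" and "play M X \<psi> \<pi>" and "i < length \<pi>"
  shows "first_order_position (\<pi> ! i)"
  using assms(3)
proof (induction i)
  case 0
  then show ?case
    using assms(1,2) by (auto simp: play_def starting_positions_def hd_conv_nth)
next
  case (Suc i)
  then show ?case
    using assms(2) by (auto simp: play_def intro: successors_first_order)
qed

lemma play_favoured:
  assumes "first_order \<psi>" and "play M X \<psi> \<pi>" and "conforms \<alpha> (favoured_moves M \<alpha>) \<pi>"
    and "\<forall>P\<in>starting_positions \<psi> X. favoured M \<alpha> P" and "i < length \<pi>"
  shows "favoured M \<alpha> (\<pi> ! i)"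
  using assms(5)
proof (induction i)
  case 0
  then show ?case
    using assms(2,4) by (auto simp: play_def hd_conv_nth)
next
  case (Suc i)
  then have fav: "favoured M \<alpha> (\<pi> ! i)" by simp
  have fo: "first_order_position (\<pi> ! i)"
    using play_first_order[OF assms(1,2)] Suc.prems by simp
  show ?case
  proof (cases "chooses \<alpha> (\<pi> ! i)")
    case True
    then have "\<pi> ! Suc i \<in> favoured_moves M \<alpha> (\<pi> ! i)"
      using assms(3) Suc.prems by (simp add: conforms_def)
    then show ?thesis using fav by (simp add: favoured_moves_def)
  next
    case False
    have "\<pi> ! Suc i \<in> successors M (\<pi> ! i)"
      using assms(2) Suc.prems by (simp add: play_def)
    then show ?thesis using favoured_opponent_move[OF fav fo False] by simp
  qed
qed

lemma strategy_for_favoured_moves: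
  assumes "Dom M \<noteq> {}" and "first_order \<psi>"
  shows "strategy_for M \<psi> \<alpha> (favoured_moves M \<alpha>)"
  unfolding strategy_for_def
proof (intro ballI impI)
  fix P assume P: "P \<in> positions M \<psi>" and ch: "chooses \<alpha> P"
  \<comment> \<open>\<open>positions\<close> contains every occurrence with every assignment into
    the domain, so an invariant along plays would not suffice here.\<close>
  have "first_order \<chi>" if "(p, \<chi>) \<in> occurrences \<psi>" for p \<chi>
    using that by (induction p \<chi> rule: occurrences.induct) (use assms(2) in auto)
  then have "first_order_position P"
    using P by (auto simp: positions_def)
  then show "favoured_moves M \<alpha> P \<noteq> {} \<and> favoured_moves M \<alpha> P \<subseteq> successors M P"
    using favoured_move_exists[of M \<alpha> P] chooses_successors_nonempty[OF assms(1) ch] ch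
    by (auto simp: favoured_moves_def)
qed

lemma uniform_first_order:
  assumes "first_order \<psi>"
  shows "uniform M X \<psi> \<alpha> \<sigma>"
proof -
  have "last \<pi> \<noteq> ((p, Dep ts us), s, \<beta>)" if "play M X \<psi> \<pi>" for \<pi> p ts us s \<beta>
  proof -
    have "\<pi> \<noteq> []" using that by (simp add: play_def)
    then have "first_order_position (last \<pi>)"
      using play_first_order[OF assms that] by (simp add: last_conv_nth)
    then show ?thesis by auto
  qed
  then show ?thesis unfolding uniform_def by blast
qed

lemma winning_favoured_moves:
  assumes "Dom M \<noteq> {}" and "first_order \<psi>"
    and "\<forall>P\<in>starting_positions \<psi> X. favoured M \<alpha> P"
  shows "winning M X \<psi> \<alpha> (favoured_moves M \<alpha>)"
  unfolding winning_def
proof (intro allI impI)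
  fix \<pi> assume play: "play M X \<psi> \<pi>" and conf: "conforms \<alpha> (favoured_moves M \<alpha>) \<pi>"
  have "\<pi> \<noteq> []" and final: "successors M (last \<pi>) = {}"
    using play by (auto simp: play_def)
  then have "favoured M \<alpha> (last \<pi>)" and "first_order_position (last \<pi>)"
    using play_favoured[OF assms(2) play conf assms(3)] play_first_order[OF assms(2) play]
    by (simp_all add: last_conv_nth)
  then show "winner M (last \<pi>) = \<alpha>"
    using winner_iff_favoured[OF assms(1) _ final] by blast
qed

text \<open>One lost conforming path refutes \<sigma>. The path may start at any position, not only
  at the root as in \<open>play\<close>, so that induction on formula size can prepend a
  move.\<close>

lemma losing_path_exists:
  assumes "Dom M \<noteq> {}" and "strategy_for M \<psi> \<alpha> \<sigma>"
    and "P \<in> positions M \<psi>" and "first_order_position P" and "\<not> favoured M \<alpha> P"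
  shows "\<exists>\<pi>. \<pi> \<noteq> [] \<and> hd \<pi> = P \<and>
           (\<forall>i. Suc i < length \<pi> \<longrightarrow> \<pi> ! Suc i \<in> successors M (\<pi> ! i)) \<and>
           successors M (last \<pi>) = {} \<and> conforms \<alpha> \<sigma> \<pi> \<and> winner M (last \<pi>) \<noteq> \<alpha>"
  using assms(3-5)
proof (induction P rule: measure_induct_rule[where f = "\<lambda>P. size (snd (fst P))"])
  case (less P)
  show ?case
  proof (cases "successors M P = {}")
    case True
    then show ?thesis
      using winner_iff_favoured[OF assms(1) less.prems(2) True] less.prems(3)
      by (intro exI[of _ "[P]"]) (auto simp: conforms_def)
  next
    case False
    \<comment> \<open>Any move allowed by \<sigma> stays outside the region; where \<alpha> does not
      choose, a suitable move is selected against \<alpha>.\<close>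
    obtain Q where Q: "Q \<in> successors M P" "\<not> favoured M \<alpha> Q" "chooses \<alpha> P \<longrightarrow> Q \<in> \<sigma> P"
    proof (cases "chooses \<alpha> P")
      case True
      then obtain Q where "Q \<in> \<sigma> P" "Q \<in> successors M P"
        using assms(2) less.prems(1) unfolding strategy_for_def by blast
      then show ?thesis
        using that unfavoured_move[OF less.prems(3,2) True] by blast
    next
      case nch: False
      then show ?thesis
        using that unfavoured_opponent_move_exists[OF less.prems(3,2) nch False] by blast
    qed
    obtain \<pi> where \<pi>: "\<pi> \<noteq> []" "hd \<pi> = Q"
      "\<forall>i. Suc i < length \<pi> \<longrightarrow> \<pi> ! Suc i \<in> successors M (\<pi> ! i)"
      "successors M (last \<pi>) = {}" "conforms \<alpha> \<sigma> \<pi>" "winner M (last \<pi>) \<noteq> \<alpha>"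
      using less.IH[OF successors_size[OF Q(1)] successors_in_positions[OF less.prems(1) Q(1)]
          successors_first_order[OF less.prems(2) Q(1)] Q(2)] by blast
    have "\<forall>i. Suc i < length (P # \<pi>) \<longrightarrow> (P # \<pi>) ! Suc i \<in> successors M ((P # \<pi>) ! i)"
      using \<pi>(1-3) Q(1) by (auto simp: nth_Cons hd_conv_nth split: nat.split)
    moreover have "conforms \<alpha> \<sigma> (P # \<pi>)"
      using \<pi>(1,2,5) Q(3) by (auto simp: conforms_def nth_Cons hd_conv_nth split: nat.split)
    ultimately show ?thesis
      using \<pi> by (intro exI[of _ "P # \<pi>"]) auto
  qed
qed

text \<open>Eloise holds all starting positions, so being favoured there means truth for Eloise and
  falsity for Abelard.\<close>

lemma has_uniform_winning_strategy_iff: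
  assumes "Dom M \<noteq> {}" and "first_order \<psi>" and "team M V X"
  shows "has_uniform_winning_strategy M X \<psi> \<alpha> \<longleftrightarrow>
           (\<forall>s\<in>X. \<alpha> = Eloise \<longleftrightarrow> tarski_sat M s \<psi>)"
proof
  assume "has_uniform_winning_strategy M X \<psi> \<alpha>"
  then obtain \<sigma> where \<sigma>: "strategy_for M \<psi> \<alpha> \<sigma>" and win: "winning M X \<psi> \<alpha> \<sigma>"
    by (auto simp: has_uniform_winning_strategy_def)
  show "\<forall>s\<in>X. \<alpha> = Eloise \<longleftrightarrow> tarski_sat M s \<psi>"
  proof (intro ballI, rule ccontr)
    fix s assume s: "s \<in> X" and "\<not> (\<alpha> = Eloise \<longleftrightarrow> tarski_sat M s \<psi>)"
    then have unfav: "\<not> favoured M \<alpha> (([], \<psi>), s, Eloise)" by simp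
    \<comment> \<open>\<sigma> is constrained only on \<open>positions\<close>; the team condition
      puts the values of \<open>s\<close> in the domain.\<close>
    have pos: "(([], \<psi>), s, Eloise) \<in> positions M \<psi>"
      using assms(3) s by (auto simp: positions_def team_def intro: occurrences.root)
    have "first_order_position (([], \<psi>), s, Eloise)" using assms(2) by simp
    from losing_path_exists[OF assms(1) \<sigma> pos this unfav]
    obtain \<pi> where "play M X \<psi> \<pi>" "conforms \<alpha> \<sigma> \<pi>" "winner M (last \<pi>) \<noteq> \<alpha>"
      using s by (auto simp: play_def starting_positions_def)
    then show False using win by (auto simp: winning_def)
  qed
next
  assume "\<forall>s\<in>X. \<alpha> = Eloise \<longleftrightarrow> tarski_sat M s \<psi>"
  then have "\<forall>P\<in>starting_positions \<psi> X. favoured M \<alpha> P"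
    by (auto simp: starting_positions_def)
  then show "has_uniform_winning_strategy M X \<psi> \<alpha>"
    unfolding has_uniform_winning_strategy_def
    using strategy_for_favoured_moves[OF assms(1,2)] uniform_first_order[OF assms(2)]
      winning_favoured_moves[OF assms(1,2)] by blast
qed

theorem theorem3p3:
  fixes S S' :: "('f, 'r) signature"
    and \<psi> :: "('f, 'r, 'v) fm"
    and M :: "('f, 'r, 'a) fo_model"
    and V :: "'v set"
    and X :: "('v, 'a) assignment set"
  assumes "fm_over S \<psi>" and "first_order \<psi>"
    and "subsignature S S'" and "model_over S' M"
    and "team M V X" and "free_vars \<psi> \<subseteq> V"
  shows "(para_sat_pos M X \<psi> \<longleftrightarrow> (\<exists>s\<in>X. tarski_sat M s \<psi>)) \<and>
         (para_sat_neg M X \<psi> \<longleftrightarrow> (\<exists>s\<in>X. \<not> tarski_sat M s \<psi>))"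
proof -
  have "Dom M \<noteq> {}" using assms(4) by (simp add: model_over_def)
  then show ?thesis
    \<comment> \<open>Negating the universal condition for Abelard gives the first clause, for
      Eloise the second.\<close>
    using has_uniform_winning_strategy_iff[OF _ assms(2,5)]
    by (simp add: para_sat_pos_def para_sat_neg_def)
qed

end
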